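(* Let $(L,[\cdot,\cdot,\cdot],\alpha,\beta)$ be a $3$-Bihom-Lie algebra over a field $\mathbb{K}$ with $\alpha,\beta$ surjective, and let $E$ be an almost product structure on $L$. Put $L_+=\{x\in L\mid Ex=x\}$ and $L_-=\{x\in L\mid Ex=-x\}$. If $$E[x,y,z]=[Ex,y,z]\quad\text{for all }x,y,z\in L,$$ then $E$ is a product structure on $L$ such that $[L_+,L_+,L_-]=[L_-,L_-,L_+]=0$, i.e., $L$ is the direct sum of $L_+$ and $L_-$.
   Context: A $3$-Bihom-Lie algebra over a field $\mathbb{K}$ is a $4$-tuple $(L,[\cdot,\cdot,\cdot],\alpha,\beta)$ consisting of a $\mathbb{K}$-vector space $L$, a $3$-linear map $[\cdot,\cdot,\cdot]\colon L\times L\times L\to L$ and two linear maps $\alpha,\beta\colon L\to L$ such that for all $x,y,z,u,v\in L$: (1) $\alpha\beta=\beta\alpha$; (2) $\alpha([x,y,z])=[\alpha(x),\alpha(y),\alpha(z)]$ and $\beta([x,y,z])=[\beta(x),\beta(y),\beta(z)]$; (3) $[\beta(x),\beta(y),\alpha(z)]=-[\beta(y),\beta(x),\alpha(z)]=-[\beta(x),\beta(z),\alpha(y)]$; (4) $[\beta^2(u),\beta^2(v),[\beta(x),\beta(y),\alpha(z)]]=[\beta^2(y),\beta^2(z),[\beta(u),\beta(v),\alpha(x)]]-[\beta^2(x),\beta^2(z),[\beta(u),\beta(v),\alpha(y)]]+[\beta^2(x),\beta^2(y),[\beta(u),\beta(v),\alpha(z)]]$. An almost product structure on $L$ is a linear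 map $E\colon L\to L$ with $E^2=\mathrm{Id}$, $E\neq\pm\mathrm{Id}$, $\alpha E=E\alpha$ and $\beta E=E\beta$. It is a product structure if for all $x,y,z\in L$, $$E[x,y,z]=[Ex,Ey,Ez]+[Ex,y,z]+[x,Ey,z]+[x,y,Ez]-E[Ex,Ey,z]-E[x,Ey,Ez]-E[Ex,y,Ez].$$ For subspaces $A,B,C\subseteq L$, $[A,B,C]$ denotes the span of all $[a,b,c]$ with $a\in A$, $b\in B$, $c\in C$.
   Formalization: The vanishing of [L_+,L_+,L_-] and [L_-,L_-,L_+] and the direct sum decomposition are stated only for fields of characteristic different from 2, since they fail in characteristic 2 (there L_+ = L_-); that E is a product structure is stated for every field. *)

theory Defs
  imports Complex_Main
begin

text \<open>
  The vector space \<open>L\<close> is the whole type \<open>'l\<close>, with \<open>'k\<close>-scalar multiplication \<open>scale\<close>.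
\<close>

locale bihom_lie3 = vector_space scale
  for scale :: "'k::field \<Rightarrow> 'l::ab_group_add \<Rightarrow> 'l" +
  fixes br :: "'l \<Rightarrow> 'l \<Rightarrow> 'l \<Rightarrow> 'l"
    and \<alpha> \<beta> :: "'l \<Rightarrow> 'l"
  assumes br_linear1: "Vector_Spaces.linear scale scale (\<lambda>x. br x y z)"
    and br_linear2: "Vector_Spaces.linear scale scale (\<lambda>y. br x y z)"
    and br_linear3: "Vector_Spaces.linear scale scale (\<lambda>z. br x y z)"
    and linear_\<alpha>: "Vector_Spaces.linear scale scale \<alpha>"
    and linear_\<beta>: "Vector_Spaces.linear scale scale \<beta>"
    and \<alpha>_\<beta>_commute: "\<alpha> (\<beta> x) = \<beta> (\<alpha> x)"
    and \<alpha>_br: "\<alpha> (br x y z) = br (\<alpha> x) (\<alpha> y) (\<alpha> z)"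
    and \<beta>_br: "\<beta> (br x y z) = br (\<beta> x) (\<beta> y) (\<beta> z)"
    and skew12: "br (\<beta> x) (\<beta> y) (\<alpha> z) = - br (\<beta> y) (\<beta> x) (\<alpha> z)"
    and skew23: "br (\<beta> x) (\<beta> y) (\<alpha> z) = - br (\<beta> x) (\<beta> z) (\<alpha> y)"
    and bihom_jacobi:
      "br (\<beta> (\<beta> u)) (\<beta> (\<beta> v)) (br (\<beta> x) (\<beta> y) (\<alpha> z)) =
         br (\<beta> (\<beta> y)) (\<beta> (\<beta> z)) (br (\<beta> u) (\<beta> v) (\<alpha> x))
       - br (\<beta> (\<beta> x)) (\<beta> (\<beta> z)) (br (\<beta> u) (\<beta> v) (\<alpha> y))
       + br (\<beta> (\<beta> x)) (\<beta> (\<beta> y)) (br (\<beta> u) (\<beta> v) (\<alpha> z))"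
begin

definition almost_product_structure :: "('l \<Rightarrow> 'l) \<Rightarrow> bool" where
  "almost_product_structure E \<longleftrightarrow>
     Vector_Spaces.linear scale scale E \<and>
     E \<circ> E = id \<and> E \<noteq> id \<and> E \<noteq> uminus \<and>
     \<alpha> \<circ> E = E \<circ> \<alpha> \<and> \<beta> \<circ> E = E \<circ> \<beta>"

definition product_structure :: "('l \<Rightarrow> 'l) \<Rightarrow> bool" where
  "product_structure E \<longleftrightarrow>
     almost_product_structure E \<and>
     (\<forall>x y z. E (br x y z) =
        br (E x) (E y) (E z) + br (E x) y z + br x (E y) z + br x y (E z)
        - E (br (E x) (E y) z) - E (br x (E y) (E z)) - E (br (E x) y (E z)))"

definition bracket_span :: "'l set \<Rightarrow> 'l set \<Rightarrow> 'l set \<Rightarrow> 'l set" where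
  "bracket_span A B C = span {br a b c | a b c. a \<in> A \<and> b \<in> B \<and> c \<in> C}"

definition bihom_subalgebra :: "'l set \<Rightarrow> bool" where
  "bihom_subalgebra A \<longleftrightarrow>
     subspace A \<and> bracket_span A A A \<subseteq> A \<and> \<alpha> ` A \<subseteq> A \<and> \<beta> ` A \<subseteq> A"

text \<open>
  Internal direct sum of algebras: on top of the vector space decomposition, the bracket is
  computed componentwise, so all mixed brackets vanish, in every order of the arguments.  For
  \<open>\<alpha>\<close> and \<open>\<beta>\<close>, componentwise computation is already part of linearity and invariance.
\<close>

definition is_direct_sum :: "'l set \<Rightarrow> 'l set \<Rightarrow> bool" where
  "is_direct_sum A B \<longleftrightarrow>
     bihom_subalgebra A \<and> bihom_subalgebra B \<and>
     A \<inter> B = {0} \<and> {a + b | a b. a \<in> A \<and> b \<in> B} = UNIV \<and>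
     (\<forall>a\<in>A. \<forall>a'\<in>A. \<forall>a''\<in>A. \<forall>b\<in>B. \<forall>b'\<in>B. \<forall>b''\<in>B.
        br (a + b) (a' + b') (a'' + b'') = br a a' a'' + br b b' b'')"

end

definition eigen_plus :: "('l \<Rightarrow> 'l) \<Rightarrow> 'l set" where
  "eigen_plus E = {x. E x = x}"

definition eigen_minus :: "('l::ab_group_add \<Rightarrow> 'l) \<Rightarrow> 'l set" where
  "eigen_minus E = {x. E x = - x}"

end

theory Submission
  imports Defs
begin

text \<open>
  Since \<open>\<alpha>\<close> and \<open>\<beta>\<close> are surjective and commute with \<open>E\<close>, the twisted skew symmetries carry
  the identity \<open>E [x, y, z] = [E x, y, z]\<close> to the other two slots, so \<open>E\<close> may be moved
  freely between the slots and out of the bracket.  With \<open>E\<^sup>2 = id\<close> both sides of the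
  product structure identity then reduce to \<open>E [x, y, z]\<close>, and a bracket with arguments in
  both eigenspaces satisfies \<open>v = - v\<close>, hence vanishes unless the characteristic is \<open>2\<close>.
\<close>

text \<open>If \<open>2 = 0\<close>, the characteristic divides 2; it cannot be 1 because
  \<open>1 \<noteq> 0\<close> in a field. Later lemmas use the condition in the form
  \<open>2 \<noteq> 0\<close>.\<close>

lemma two_neq_zero_if_CHAR_neq_2:
  assumes "CHAR('k::field) \<noteq> 2"
  shows "(2::'k) \<noteq> 0"
proof
  assume "(2::'k) = 0"
  then have "CHAR('k) dvd 2"
    using of_nat_eq_0_iff_char_dvd[where 'a='k and n=2] by simp
  then have "CHAR('k) \<le> 2" "CHAR('k) \<noteq> 0"
    by (auto simp: dvd_imp_le intro!: Nat.gr0I)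
  moreover have "CHAR('k) \<noteq> 1"
    by (metis of_nat_1 of_nat_CHAR zero_neq_one)
  ultimately show False
    using assms by linarith
qed

context vector_space
begin

lemma eq_uminus_self_imp_zero:
  assumes "(2::'a) \<noteq> 0" and "(v::'b) = - v"
  shows "v = 0"
proof -
  have "scale 2 v = v + v"
    using scale_left_distrib[of 1 1 v] by simp
  also have "\<dots> = 0"
    using assms(2) by (metis add.right_inverse)
  finally show ?thesis
    using assms(1) by simp
qed

lemma eigen_plus_subspace:
  assumes "Vector_Spaces.linear scale scale E"
  shows "subspace (eigen_plus E)"
proof -
  interpret E: Vector_Spaces.linear scale scale E by fact
  show ?thesis
    by (simp add: subspace_def eigen_plus_def E.add E.scale)
qed

lemma eigen_minus_subspace:
  assumes "Vector_Spaces.linear scale scale E"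
  shows "subspace (eigen_minus E)"
proof -
  interpret E: Vector_Spaces.linear scale scale E by fact
  show ?thesis
    by (simp add: subspace_def eigen_minus_def E.add E.scale)
qed

lemma eigen_Int:
  assumes "(2::'a) \<noteq> 0" and "Vector_Spaces.linear scale scale E"
  shows "eigen_plus E \<inter> eigen_minus E = {0}"
proof -
  interpret E: Vector_Spaces.linear scale scale E by fact
  show ?thesis
    using eq_uminus_self_imp_zero[OF assms(1)] by (auto simp: eigen_plus_def eigen_minus_def)
qed

text \<open>The two summands come from the projections \<open>(id + E)/2\<close> and
  \<open>(id - E)/2\<close> onto the eigenspaces.\<close>

lemma eigen_sum:
  assumes "(2::'a) \<noteq> 0" and "Vector_Spaces.linear scale scale E" and "\<And>x. E (E x) = x"
  shows "{a + b | a b. a \<in> eigen_plus E \<and> b \<in> eigen_minus E} = UNIV"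
proof -
  interpret E: Vector_Spaces.linear scale scale E by fact
  have "\<exists>a b. x = a + b \<and> a \<in> eigen_plus E \<and> b \<in> eigen_minus E" for x
  proof (intro exI conjI)
    have "scale (1/2) x + scale (1/2) x = scale (1/2 + 1/2) x"
      by (simp only: scale_left_distrib)
    also have "(1/2 + 1/2 :: 'a) = 1"
      using assms(1) by (simp flip: add_divide_distrib)
    finally show "x = scale (1/2) (x + E x) + scale (1/2) (x - E x)"
      by (simp add: scale_right_distrib scale_right_diff_distrib)
    show "scale (1/2) (x + E x) \<in> eigen_plus E"
      by (simp add: eigen_plus_def E.scale E.add assms(3) add.commute)
    show "scale (1/2) (x - E x) \<in> eigen_minus E"
      by (simp add: eigen_minus_def E.scale E.diff assms(3) flip: scale_minus_right)
  qed
  then show ?thesis by auto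
qed

end

context bihom_lie3
begin

lemma br_add:
  "br (x + x') y z = br x y z + br x' y z"
  "br x (y + y') z = br x y z + br x y' z"
  "br x y (z + z') = br x y z + br x y z'"
  using module_hom.add[OF Vector_Spaces.linear.axioms(3)[OF br_linear1]]
    module_hom.add[OF Vector_Spaces.linear.axioms(3)[OF br_linear2]]
    module_hom.add[OF Vector_Spaces.linear.axioms(3)[OF br_linear3]] by auto

lemma br_minus:
  "br (- x) y z = - br x y z"
  "br x (- y) z = - br x y z"
  "br x y (- z) = - br x y z"
  using module_hom.neg[OF Vector_Spaces.linear.axioms(3)[OF br_linear1]]
    module_hom.neg[OF Vector_Spaces.linear.axioms(3)[OF br_linear2]]
    module_hom.neg[OF Vector_Spaces.linear.axioms(3)[OF br_linear3]] by auto

lemma bracket_span_subset: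
  assumes "subspace S" and "\<And>a b c. a \<in> A \<Longrightarrow> b \<in> B \<Longrightarrow> c \<in> C \<Longrightarrow> br a b c \<in> S"
  shows "bracket_span A B C \<subseteq> S"
  unfolding bracket_span_def using assms by (intro span_minimal) auto

lemma bracket_span_eq_zero:
  assumes "\<And>a b c. a \<in> A \<Longrightarrow> b \<in> B \<Longrightarrow> c \<in> C \<Longrightarrow> br a b c = 0"
  shows "bracket_span A B C = {0}"
  using bracket_span_subset[OF subspace_single_0, of A B C] assms
  by (auto simp: bracket_span_def span_zero)

end

text \<open>The condition on the characteristic stays outside, since the product structure identity
  holds over every field.\<close>

locale slotwise_almost_product = bihom_lie3 +
  fixes E :: "'b \<Rightarrow> 'b"
  assumes surj_\<alpha>: "surj \<alpha>" and surj_\<beta>: "surj \<beta>"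
    and almost_product: "almost_product_structure E"
    and E_br1: "E (br x y z) = br (E x) y z"
begin

lemma linear_E: "Vector_Spaces.linear scale scale E"
  and E_E: "E (E x) = x"
  and \<alpha>_E: "\<alpha> (E x) = E (\<alpha> x)"
  and \<beta>_E: "\<beta> (E x) = E (\<beta> x)"
  using almost_product by (auto simp: almost_product_structure_def fun_eq_iff)

sublocale E: Vector_Spaces.linear scale scale E
  by (fact linear_E)

lemma E_br2: "br x (E y) z = E (br x y z)"
proof -
  \<comment> \<open>Surjectivity gives arbitrary arguments the twisted form that
    \<open>skew12\<close> requires; swapping the first two slots then reduces the claim to
    \<open>E_br1\<close>.\<close>
  obtain a b c where [simp]: "x = \<beta> a" "y = \<beta> b" "z = \<alpha> c"
    using surj_\<alpha> surj_\<beta> by (meson surjD)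
  have "br x (E y) z = - br (\<beta> (E b)) (\<beta> a) (\<alpha> c)"
    using skew12[of a "E b" c] by (simp add: \<beta>_E)
  also have "\<dots> = - E (br (\<beta> b) (\<beta> a) (\<alpha> c))"
    by (simp add: E_br1 \<beta>_E)
  also have "\<dots> = E (br x y z)"
    using skew12[of a b c] by (simp add: E.neg)
  finally show ?thesis .
qed

lemma E_br3: "br x y (E z) = E (br x y z)"
proof -
  obtain a b c where [simp]: "x = \<beta> a" "y = \<beta> b" "z = \<alpha> c"
    using surj_\<alpha> surj_\<beta> by (meson surjD)
  \<comment> \<open>The swap moves \<open>E c\<close> from under \<alpha> to under \<beta>, so
    \<open>E\<close> has to commute with both maps.\<close>
  have "br x y (E z) = - br (\<beta> a) (\<beta> (E c)) (\<alpha> b)"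
    using skew23[of a b "E c"] by (simp add: \<alpha>_E)
  also have "\<dots> = - E (br (\<beta> a) (\<beta> c) (\<alpha> b))"
    by (simp add: E_br2 \<beta>_E)
  also have "\<dots> = E (br x y z)"
    using skew23[of a b c] by (simp add: E.neg)
  finally show ?thesis .
qed

lemmas E_br = E_br1[symmetric] E_br2 E_br3

text \<open>Once every \<open>E\<close> is pulled out and \<open>E_E\<close> applied, each of the
  seven terms on the right is \<open>E (br x y z)\<close>: four with a plus sign, three with a minus
  sign.\<close>

lemma product_structure_E: "product_structure E"
  unfolding product_structure_def by (simp add: almost_product E_br E_E)

lemma bihom_subalgebra_eigen_plus: "bihom_subalgebra (eigen_plus E)"
  unfolding bihom_subalgebra_def
proof (intro conjI)
  show "subspace (eigen_plus E)"
    by (rule eigen_plus_subspace[OF linear_E])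
  then show "bracket_span (eigen_plus E) (eigen_plus E) (eigen_plus E) \<subseteq> eigen_plus E"
    by (rule bracket_span_subset) (simp add: eigen_plus_def E_br1)
qed (auto simp: eigen_plus_def simp flip: \<alpha>_E \<beta>_E)

lemma bihom_subalgebra_eigen_minus: "bihom_subalgebra (eigen_minus E)"
  unfolding bihom_subalgebra_def
proof (intro conjI)
  interpret \<alpha>: Vector_Spaces.linear scale scale \<alpha> by (fact linear_\<alpha>)
  interpret \<beta>: Vector_Spaces.linear scale scale \<beta> by (fact linear_\<beta>)
  show "subspace (eigen_minus E)"
    by (rule eigen_minus_subspace[OF linear_E])
  then show "bracket_span (eigen_minus E) (eigen_minus E) (eigen_minus E) \<subseteq> eigen_minus E"
    by (rule bracket_span_subset) (simp add: eigen_minus_def E_br1 br_minus)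
  show "\<alpha> ` eigen_minus E \<subseteq> eigen_minus E" "\<beta> ` eigen_minus E \<subseteq> eigen_minus E"
    by (auto simp: eigen_minus_def \<alpha>.neg \<beta>.neg simp flip: \<alpha>_E \<beta>_E)
qed

text \<open>Applying \<open>E\<close> to the bracket through the slot of \<open>a\<close> fixes it,
  and through the slot of \<open>b\<close> negates it. The remaining argument \<open>x\<close> is
  arbitrary, so all placements of \<open>a\<close> and \<open>b\<close> are covered.\<close>

lemma mixed_br_zero:
  assumes "(2::'a) \<noteq> 0" and "a \<in> eigen_plus E" and "b \<in> eigen_minus E"
  shows "br a b x = 0" "br b a x = 0" "br a x b = 0" "br b x a = 0" "br x a b = 0" "br x b a = 0"
proof -
  have E: "E a = a" "E b = - b"
    using assms by (auto simp: eigen_plus_def eigen_minus_def)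
  note zero = eq_uminus_self_imp_zero[OF assms(1)]
  show "br a b x = 0" "br b a x = 0"
    using E_br(1,2)[of a b x] E_br(1,2)[of b a x] by (auto intro!: zero simp: E br_minus)
  show "br a x b = 0" "br b x a = 0"
    using E_br(1,3)[of a x b] E_br(1,3)[of b x a] by (auto intro!: zero simp: E br_minus)
  show "br x a b = 0" "br x b a = 0"
    using E_br(2,3)[of x a b] E_br(2,3)[of x b a] by (auto intro!: zero simp: E br_minus)
qed

text \<open>Expanding a bracket of three sums gives eight terms; the six mixed ones vanish by
  \<open>mixed_br_zero\<close>.\<close>

lemma is_direct_sum_eigen:
  assumes "(2::'a) \<noteq> 0"
  shows "is_direct_sum (eigen_plus E) (eigen_minus E)"
  unfolding is_direct_sum_def
  using bihom_subalgebra_eigen_plus bihom_subalgebra_eigen_minus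
    eigen_Int[OF assms linear_E] eigen_sum[OF assms linear_E E_E]
  by (simp add: br_add mixed_br_zero[OF assms])

end

text \<open>In characteristic 2 the eigenspaces coincide and contain the image of
  \<open>E + id\<close>, which is nonzero because \<open>E\<close> is not minus the identity. They
  then have no direct sum, hence the guard on the second part.\<close>

theorem proposition3p4:
  fixes scale :: "'k::field \<Rightarrow> 'l::ab_group_add \<Rightarrow> 'l"
    and br :: "'l \<Rightarrow> 'l \<Rightarrow> 'l \<Rightarrow> 'l"
    and \<alpha> \<beta> E :: "'l \<Rightarrow> 'l"
  assumes "bihom_lie3 scale br \<alpha> \<beta>"
    and "surj \<alpha>" and "surj \<beta>"
    and "bihom_lie3.almost_product_structure scale \<alpha> \<beta> E"
    and "\<And>x y z. E (br x y z) = br (E x) y z"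
  shows "bihom_lie3.product_structure scale br \<alpha> \<beta> E \<and>
    (CHAR('k) \<noteq> 2 \<longrightarrow>
       bihom_lie3.bracket_span scale br (eigen_plus E) (eigen_plus E) (eigen_minus E) = {0} \<and>
       bihom_lie3.bracket_span scale br (eigen_minus E) (eigen_minus E) (eigen_plus E) = {0} \<and>
       bihom_lie3.is_direct_sum scale br \<alpha> \<beta> (eigen_plus E) (eigen_minus E))"
proof -
  interpret bihom_lie3 scale br \<alpha> \<beta> by fact
  interpret slotwise_almost_product scale br \<alpha> \<beta> E
    by unfold_locales (use assms in auto)
  show ?thesis
    using product_structure_E is_direct_sum_eigen two_neq_zero_if_CHAR_neq_2[where 'k='k]
    by (intro conjI impI bracket_span_eq_zero) (auto simp: mixed_br_zero)
qed

end
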